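(* Let $H$ be an $r$-uniform hypergraph on $n$ vertices and $k\ge1$ an integer such that $f(H,1,k)=0$. Then $$e(H)\le \binom{n}{r}-r\binom{n/r}{r}+(k-1)n,$$ and this bound is sharp for $n>(k-1)r^{2r-1}$ when $r^2$ divides $n$ (i.e. for such $n$ there is an $r$-uniform hypergraph $H$ on $n$ vertices with $f(H,1,k)=0$ attaining equality).
   Context: $e(H)$ is the number of edges of $H$; $\binom{x}{r}=x(x-1)\cdots(x-r+1)/r!$ for real $x$. An orientation $D$ of an $r$-uniform hypergraph $H$ assigns to each edge a linear ordering of its $r$ vertices (positions $1,\dots,r$); $\deg_i(v)$ is the number of edges in which $v$ occupies position $i$. $f(D,1,k)$ is the number of vertices $v$ with $\deg_i(v)\ge k$ for all $1\le i\le r$, and $f(H,1,k)$ is the minimum of $f(D,1,k)$ over all orientations $D$ of $H$.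
   Formalization: The upper bound is proved when k≥2, or n≥r(r−1), or binom(n/r,r)≤0 (otherwise it fails, e.g. r=4, n=6, k=1, complete H); r≥1 is assumed, and sharpness is stated for r≥2 (it fails for r=1, k≥3). *)

theory Defs
  imports "HOL-Combinatorics.Multiset_Permutations" Complex_Main
begin

definition uniform_hypergraph :: "nat \<Rightarrow> 'a set \<Rightarrow> 'a set set \<Rightarrow> bool" where
  "uniform_hypergraph r V E \<longleftrightarrow> finite V \<and> (\<forall>e\<in>E. e \<subseteq> V \<and> card e = r)"

text \<open>An orientation lists the vertices of each edge in some order, without repetition.
  Orientations are taken to be undefined off the edge set, so that a finite
  hypergraph has only finitely many of them.\<close>

definition orientations :: "'a set set \<Rightarrow> ('a set \<Rightarrow> 'a list) set" where
  "orientations E = (\<Pi>\<^sub>E e\<in>E. permutations_of_set e)"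

text \<open>Positions are numbered from 1, whereas list indices start at 0.\<close>

definition pos_deg :: "'a set set \<Rightarrow> ('a set \<Rightarrow> 'a list) \<Rightarrow> nat \<Rightarrow> 'a \<Rightarrow> nat" where
  "pos_deg E D i v = card {e \<in> E. D e ! (i - 1) = v}"

definition f_orientation ::
  "nat \<Rightarrow> 'a set \<Rightarrow> 'a set set \<Rightarrow> ('a set \<Rightarrow> 'a list) \<Rightarrow> nat \<Rightarrow> nat" where
  "f_orientation r V E D k = card {v \<in> V. \<forall>i\<in>{1..r}. k \<le> pos_deg E D i v}"

definition f_hypergraph :: "nat \<Rightarrow> 'a set \<Rightarrow> 'a set set \<Rightarrow> nat \<Rightarrow> nat" where
  "f_hypergraph r V E k = Min ((\<lambda>D. f_orientation r V E D k) ` orientations E)"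

lemma orientations_finite_nonempty:
  assumes "uniform_hypergraph r V E"
  shows "finite (orientations E)" "orientations E \<noteq> {}"
proof -
  have fin: "finite e" if "e \<in> E" for e
    using assms that by (auto simp: uniform_hypergraph_def intro: finite_subset)
  have "E \<subseteq> Pow V" "finite V"
    using assms by (auto simp: uniform_hypergraph_def)
  then have "finite E"
    by (meson finite_Pow_iff finite_subset)
  then show "finite (orientations E)"
    unfolding orientations_def by (intro finite_PiE) auto
  show "orientations E \<noteq> {}"
    unfolding orientations_def using fin by (auto simp: PiE_eq_empty_iff)
qed

text \<open>
  The binomial coefficient of a real number is the polynomial \<^term>\<open>(x::real) gchoose r\<close>.
  It can be positive for some non-integral \<open>x < r - 1\<close>, and then, for \<open>k = 1\<close>, the bound
  \<open>e(H) \<le> (n choose r) - r * ((n / r) gchoose r) + (k - 1) * n\<close> fails: if \<open>n \<le> r * (r - 1)\<close>,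
  split the vertices into \<open>r\<close> classes of size less than \<open>r\<close>; by Hall's theorem each edge of the
  complete hypergraph can be ordered so that no vertex of the \<open>i\<close>-th class is in position \<open>i\<close>.
  The following lemma is the instance \<open>r = 4\<close>, \<open>n = 6\<close>. Hence the bound needs the side condition
  \<open>2 \<le> k \<or> r * (r - 1) \<le> n \<or> (n / r) gchoose r \<le> 0\<close>, which
  excludes exactly these counterexamples.

  Sharpness needs \<open>r \<ge> 2\<close>: for \<open>r = 1\<close> there are at most \<open>n\<close> edges, while the bound
  is \<open>(k - 1) * n\<close>.
\<close>

lemma bound_fails_without_side_condition:
  "\<exists>(V::nat set) E. uniform_hypergraph 4 V E \<and> card V = 6 \<and> f_hypergraph 4 V E 1 = 0
     \<and> real (card E) > real (6 choose 4) - 4 * ((6 / 4) gchoose 4) + (1 - 1) * 6"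
proof -
  define L :: "nat list list" where "L =
    [[1,0,3,2], [1,0,4,2], [1,0,5,2], [1,0,3,4], [1,0,3,5], [1,0,4,5], [2,0,3,4], [2,0,3,5],
     [2,0,4,5], [3,0,4,5], [1,2,3,4], [1,2,3,5], [1,2,4,5], [1,3,4,5], [2,3,4,5]]"
  define V :: "nat set" where "V = {..<6}"
  define E where "E = set ` set L"
  define D where "D = (\<lambda>e\<in>E. SOME xs. xs \<in> set L \<and> set xs = e)"
  have L: "\<forall>xs\<in>set L. distinct xs \<and> length xs = 4 \<and> set xs \<subseteq> V \<and>
      xs ! 0 mod 4 \<noteq> 0 \<and> xs ! 1 mod 4 \<noteq> 1 \<and> xs ! 2 mod 4 \<noteq> 2 \<and> xs ! 3 mod 4 \<noteq> 3"
    unfolding L_def V_def by simp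
  have "map sorted_list_of_set (map set L) = map sort L" "distinct (map sort L)"
    unfolding L_def by (simp_all add: sorted_list_of_set_sort_remdups)
  then have "distinct (map set L)"
    by (metis distinct_map)
  then have cardE: "card E = 15"
    unfolding E_def using distinct_card[of "map set L"] by (simp add: L_def)
  have H: "uniform_hypergraph 4 V E"
    using L by (auto simp: uniform_hypergraph_def E_def V_def distinct_card)
  have D: "D e \<in> set L \<and> set (D e) = e" if "e \<in> E" for e
  proof -
    have "\<exists>xs. xs \<in> set L \<and> set xs = e"
      using that by (auto simp: E_def)
    from someI_ex[OF this] show ?thesis
      using that by (simp add: D_def)
  qed
  have "D \<in> orientations E"
    unfolding orientations_def permutations_of_set_def using D L by (auto simp: D_def)
  moreover have "f_orientation 4 V E D 1 = 0"
  proof -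
    have "pos_deg E D (v mod 4 + 1) v = 0" for v
    proof -
      have "v mod 4 = 0 \<or> v mod 4 = 1 \<or> v mod 4 = 2 \<or> v mod 4 = 3"
        by linarith
      then have "D e ! (v mod 4) \<noteq> v" if "e \<in> E" for e
        using D[OF that] L by metis
      then have "{e \<in> E. D e ! (v mod 4) = v} = {}"
        by blast
      then show ?thesis
        unfolding pos_deg_def by (simp only: add_diff_cancel_right' card.empty)
    qed
    moreover have "v mod 4 + 1 \<in> {1..4}" for v :: nat
      by (simp add: Suc_leI)
    ultimately have "{v \<in> V. \<forall>i\<in>{1..4}. 1 \<le> pos_deg E D i v} = {}"
      by (metis (no_types, lifting) empty_Collect_eq not_one_le_zero)
    then show ?thesis
      unfolding f_orientation_def by (metis card.empty)
  qed
  ultimately have "0 \<in> (\<lambda>D. f_orientation 4 V E D 1) ` orientations E"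
    by force
  then have "f_hypergraph 4 V E 1 = 0"
    unfolding f_hypergraph_def using orientations_finite_nonempty[OF H]
    by (meson Min_le finite_imageI le_zero_eq)
  moreover have "(6 choose 4 :: nat) = 15"
    by (simp add: eval_nat_numeral)
  moreover have "((6 / 4 :: real) gchoose 4) > 0"
    by (simp add: gbinomial_prod_rev eval_nat_numeral)
  ultimately show ?thesis
    using H cardE by (intro exI[of _ V] exI[of _ E]) (simp add: V_def)
qed

end

theory Submission
  imports Defs "HOL-Analysis.Convex"
begin

text \<open>An orientation witnessing \<open>f(H,1,k) = 0\<close> colours each vertex \<open>v\<close> with a position \<open>i\<close> where
  \<open>deg\<^sub>i(v) < k\<close>. At most \<open>(k - 1) n\<close> edges have a vertex of colour \<open>i\<close> in position \<open>i\<close> for some \<open>i\<close>,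
  and no other edge is monochromatic; convexity of the binomial coefficient bounds the number of
  monochromatic \<open>r\<close>-sets from below. Conversely, with \<open>r\<close> colour classes of equal size, every
  \<open>r\<close>-set that is not monochromatic can be ordered with no vertex of colour \<open>i\<close> in position \<open>i\<close>,
  and \<open>k - 1\<close> monochromatic edges can be added for each vertex, which occupies in them the
  position given by its colour.\<close>

section \<open>Binomial coefficients of a real argument: convexity and bounds for small
  arguments\<close>

lemma gbinomial_mono_pred:
  fixes a b :: real
  assumes "real k - 1 \<le> a" "a \<le> b"
  shows "a gchoose k \<le> b gchoose k"
  using assms by (force simp: gbinomial_prod_rev intro!: divide_right_mono prod_mono)

text \<open>Jensen's inequality for \<open>x gchoose r\<close>, which is convex for
  \<open>x \<ge> r - 1\<close>. The last assumption puts the mean of the \<open>m i\<close> in this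
  range, where passing to larger values can only increase the polynomial.\<close>

lemma sum_choose_ge_card_mult_gbinomial:
  fixes m :: "'i \<Rightarrow> nat"
  assumes "finite I" "I \<noteq> {}" "1 \<le> r" "(real r - 1) * card I \<le> (\<Sum>i\<in>I. real (m i))"
  shows "card I * (((\<Sum>i\<in>I. real (m i)) / card I) gchoose r) \<le> (\<Sum>i\<in>I. real (m i choose r))"
proof -
  \<comment> \<open>Raising the \<open>m i\<close> to \<open>r - 1\<close>, where the polynomial becomes convex and increasing,
    does not change the binomial coefficients.\<close>
  define M where "M i = max (m i) (r - 1)" for i
  have M: "M i choose r = m i choose r" for i
    using assms(3) by (cases "m i < r") (auto simp: M_def max_def binomial_eq_0)
  have pos: "0 < real (card I)"
    using assms(1,2) by (simp add: card_gt_0_iff)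
  have "(\<Sum>i\<in>I. real (m i)) / card I \<le> (\<Sum>i\<in>I. real (M i)) / card I"
    by (intro divide_right_mono sum_mono) (auto simp: M_def)
  also have "\<dots> = (\<Sum>i\<in>I. (1 / card I) *\<^sub>R real (M i))"
    by (simp add: sum_divide_distrib)
  finally have "((\<Sum>i\<in>I. real (m i)) / card I) gchoose r \<le> (\<Sum>i\<in>I. (1 / card I) *\<^sub>R real (M i)) gchoose r"
    using assms(4) pos by (intro gbinomial_mono_pred) (auto simp: field_simps)
  also have "\<dots> \<le> (\<Sum>i\<in>I. (1 / card I) * (real (M i) gchoose r))"
  proof (rule convex_on_sum[OF assms(1,2) convex_gchoose])
    show "real (M i) \<in> {real r - 1..}" for i
      using assms(3) by (auto simp: M_def)
  qed (use pos in auto)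
  also have "\<dots> = (\<Sum>i\<in>I. real (m i choose r)) / card I"
    by (simp add: sum_divide_distrib M flip: binomial_gbinomial)
  finally show ?thesis
    using pos by (simp add: field_simps)
qed

text \<open>Induction on \<open>r\<close>. For \<open>x \<ge> 0\<close> absorption leads to
  \<open>x - 1\<close>, which is why the interval starts at \<open>- 1\<close>; for negative
  \<open>x\<close> the last factor \<open>(x - r) / (r + 1)\<close> has absolute value at most
  1.\<close>

lemma abs_gbinomial_le_1:
  fixes x :: real
  assumes "- 1 \<le> x" "x \<le> real r"
  shows "\<bar>x gchoose r\<bar> \<le> 1"
  using assms
proof (induction r arbitrary: x)
  case 0
  then show ?case by simp
next
  case (Suc r)
  show ?case
  proof (cases "0 \<le> x")
    case True
    have "\<bar>x gchoose Suc r\<bar> = (x / real (Suc r)) * \<bar>(x - 1) gchoose r\<bar>"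
      using True by (subst gbinomial_absorption') (auto simp: abs_mult)
    also have "\<dots> \<le> 1 * 1"
      using True Suc by (intro mult_mono) auto
    finally show ?thesis by simp
  next
    case False
    have "x gchoose Suc r = (x - real r) / real (Suc r) * (x gchoose r)"
      using gbinomial_mult_1[of x r] by (simp add: field_simps)
    then have "\<bar>x gchoose Suc r\<bar> = \<bar>(x - real r) / real (Suc r)\<bar> * \<bar>x gchoose r\<bar>"
      by (simp only: abs_mult)
    also have "\<dots> \<le> 1 * 1"
      using False Suc by (intro mult_mono) (auto simp: divide_simps)
    finally show ?thesis by simp
  qed
qed

text \<open>Absorption leaves \<open>x / r\<close> times a coefficient of absolute value at most 1.
  With \<open>x = n / r\<close> this bounds \<open>r * ((n / r) gchoose r)\<close> by
  \<open>n\<close> when \<open>n \<le> r * r\<close>, which the term \<open>(k - 1) * n\<close>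
  absorbs for \<open>k \<ge> 2\<close>.\<close>

lemma gbinomial_le_self:
  fixes x :: real
  assumes "1 \<le> r" "0 \<le> x" "x \<le> real r"
  shows "x gchoose r \<le> x"
proof -
  have "x gchoose r = (x / real r) * ((x - 1) gchoose (r - 1))"
    using assms by (intro gbinomial_absorption') auto
  also have "\<dots> \<le> (x / real r) * 1"
    using abs_gbinomial_le_1[of "x - 1" "r - 1"] assms by (intro mult_left_mono) auto
  also have "\<dots> \<le> x"
    using assms mult_left_mono[of 1 "real r" x] by (simp add: field_simps)
  finally show ?thesis .
qed

section \<open>The upper bound: counting edges that are not monochromatic\<close>

definition cross_edges :: "nat \<Rightarrow> 'a set \<Rightarrow> ('a \<Rightarrow> nat) \<Rightarrow> 'a set set" where
  "cross_edges r V c = {e. e \<subseteq> V \<and> card e = r \<and> (\<forall>i\<in>{1..r}. \<not> e \<subseteq> {v \<in> V. c v = i})}"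

lemma finite_cross_edges: "finite V \<Longrightarrow> finite (cross_edges r V c)"
  by (rule finite_subset[of _ "Pow V"]) (auto simp: cross_edges_def)

text \<open>Since \<open>r \<ge> 1\<close>, a monochromatic \<open>r\<close>-set is nonempty and so
  has only one colour; no set is counted twice in the sum.\<close>

lemma card_cross_edges:
  assumes "finite V" "1 \<le> r"
  shows "card (cross_edges r V c) + (\<Sum>i=1..r. card {v \<in> V. c v = i} choose r) = card V choose r"
proof -
  define M where "M i = {e. e \<subseteq> {v \<in> V. c v = i} \<and> card e = r}" for i
  have finM: "finite (M i)" for i
    by (rule finite_subset[of _ "Pow V"]) (use assms in \<open>auto simp: M_def\<close>)
  have ne: "e \<noteq> {}" if "e \<in> M i" for e i
    using that assms(2) by (auto simp: M_def)
  have disj: "M i \<inter> M j = {}" if "i \<noteq> j" for i j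
  proof (rule ccontr)
    assume "M i \<inter> M j \<noteq> {}"
    then obtain e where e: "e \<in> M i" "e \<in> M j" by auto
    with ne obtain v where "v \<in> e" by blast
    with e that show False by (auto simp: M_def)
  qed
  have "{e. e \<subseteq> V \<and> card e = r} = cross_edges r V c \<union> (\<Union>i\<in>{1..r}. M i)"
    by (auto simp: cross_edges_def M_def)
  moreover have "cross_edges r V c \<inter> (\<Union>i\<in>{1..r}. M i) = {}"
    by (auto simp: cross_edges_def M_def)
  moreover have "card (\<Union>i\<in>{1..r}. M i) = (\<Sum>i=1..r. card (M i))"
    using finM disj by (intro card_UN_disjoint) auto
  moreover have "card (M i) = card {v \<in> V. c v = i} choose r" for i
    unfolding M_def using assms(1) by (intro n_subsets) auto
  ultimately show ?thesis
    using n_subsets[OF assms(1), of r] finite_cross_edges[OF assms(1)] finM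
    by (simp add: card_Un_disjoint)
qed

lemma f_hypergraph_eq_0_iff:
  assumes "uniform_hypergraph r V E"
  shows "f_hypergraph r V E k = 0 \<longleftrightarrow>
    (\<exists>D\<in>orientations E. \<forall>v\<in>V. \<exists>i\<in>{1..r}. pos_deg E D i v < k)"
proof -
  let ?A = "(\<lambda>D. f_orientation r V E D k) ` orientations E"
  have A: "finite ?A" "?A \<noteq> {}"
    using orientations_finite_nonempty[OF assms] by auto
  have V: "finite V"
    using assms by (simp add: uniform_hypergraph_def)
  have zero: "f_orientation r V E D k = 0 \<longleftrightarrow> (\<forall>v\<in>V. \<exists>i\<in>{1..r}. pos_deg E D i v < k)" for D
    unfolding f_orientation_def using V by (simp add: card_eq_0_iff) (meson not_le)
  have "f_hypergraph r V E k = 0 \<longleftrightarrow> 0 \<in> ?A"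
    unfolding f_hypergraph_def using A by (metis Min_in Min_le le_zero_eq)
  also have "\<dots> \<longleftrightarrow> (\<exists>D\<in>orientations E. f_orientation r V E D k = 0)"
    by (auto simp: image_iff)
  finally show ?thesis
    by (simp only: zero)
qed

lemma card_le_cross_edges:
  assumes H: "uniform_hypergraph r V E" and f: "f_hypergraph r V E k = 0"
  obtains c where "c \<in> V \<rightarrow> {1..r}" "card E \<le> card (cross_edges r V c) + (k - 1) * card V"
proof -
  have V: "finite V" and E: "\<And>e. e \<in> E \<Longrightarrow> e \<subseteq> V \<and> card e = r"
    using H by (auto simp: uniform_hypergraph_def)
  have finE: "finite E"
    using V E by (meson Pow_iff finite_Pow_iff finite_subset subsetI)
  obtain D where D: "D \<in> orientations E" and "\<forall>v\<in>V. \<exists>i\<in>{1..r}. pos_deg E D i v < k"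
    using f f_hypergraph_eq_0_iff[OF H] by blast
  then obtain c where c: "\<And>v. v \<in> V \<Longrightarrow> c v \<in> {1..r} \<and> pos_deg E D (c v) v < k"
    by metis
  \<comment> \<open>The edges with some vertex in the position named by its colour. Each vertex
    accounts for \<open>pos_deg E D (c v) v \<le> k - 1\<close> of them.\<close>
  define B where "B = (\<Union>v\<in>V. {e \<in> E. D e ! (c v - 1) = v})"
  have "card B \<le> (\<Sum>v\<in>V. card {e \<in> E. D e ! (c v - 1) = v})"
    unfolding B_def by (rule card_UN_le[OF V])
  also have "\<dots> \<le> (\<Sum>v\<in>V. k - 1)"
    using c by (intro sum_mono) (fastforce simp: pos_deg_def)
  finally have cardB: "card B \<le> (k - 1) * card V"
    by (simp add: mult.commute)
  have "E \<subseteq> cross_edges r V c \<union> B"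
  proof
    fix e assume e: "e \<in> E"
    show "e \<in> cross_edges r V c \<union> B"
    proof (cases "e \<in> cross_edges r V c")
      case False
      then obtain i where i: "i \<in> {1..r}" "e \<subseteq> {v \<in> V. c v = i}"
        using E[OF e] by (auto simp: cross_edges_def)
      have De: "D e \<in> permutations_of_set e"
        using D e by (auto simp: orientations_def)
      then have "length (D e) = r"
        using E[OF e] by (simp add: length_finite_permutations_of_set)
      with De i have "D e ! (i - 1) \<in> e"
        by (metis One_nat_def Suc_le_eq Suc_pred atLeastAtMost_iff less_le_trans nth_mem
            permutations_of_setD(1) zero_less_Suc le_eq_less_or_eq lessI)
      \<comment> \<open>All of \<open>e\<close> has colour \<open>i\<close>, so whichever vertex is
        in position \<open>i\<close> puts \<open>e\<close> into \<open>B\<close>.\<close>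
      with i e show ?thesis
        by (auto simp: B_def intro!: bexI[of _ "D e ! (i - 1)"])
    qed simp
  qed
  moreover have "finite B"
    using finE V by (simp add: B_def)
  ultimately have "card E \<le> card (cross_edges r V c \<union> B)"
    using finite_cross_edges[OF V] by (intro card_mono) auto
  also have "\<dots> \<le> card (cross_edges r V c) + card B"
    by (rule card_Un_le)
  finally show ?thesis
    using that[of c] c cardB by fastforce
qed

text \<open>For \<open>n \<ge> r * (r - 1)\<close> convexity applies to the colour classes. For
  smaller \<open>n\<close> the bound is at least \<open>n choose r\<close>: the subtracted term is
  at most \<open>(k - 1) * n\<close> if \<open>k \<ge> 2\<close>, and at most 0 by the side
  condition if \<open>k = 1\<close>.\<close>

lemma card_le_of_f_hypergraph_eq_0:
  assumes "1 \<le> r" "1 \<le> k"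
    and H: "uniform_hypergraph r V E" and f: "f_hypergraph r V E k = 0" and n: "card V = n"
    and side: "2 \<le> k \<or> r * (r - 1) \<le> n \<or> (real n / real r) gchoose r \<le> 0"
  shows "real (card E) \<le> real (n choose r) - real r * ((real n / real r) gchoose r)
           + (real k - 1) * real n"
proof -
  have V: "finite V"
    using H by (simp add: uniform_hypergraph_def)
  obtain c where c: "c \<in> V \<rightarrow> {1..r}"
    and E: "card E \<le> card (cross_edges r V c) + (k - 1) * card V"
    using card_le_cross_edges[OF H f] .
  let ?m = "\<lambda>i. card {v \<in> V. c v = i}"
  have "real (card E) \<le> real (card (cross_edges r V c) + (k - 1) * n)"
    using E unfolding n of_nat_le_iff .
  moreover have "real (card (cross_edges r V c)) + (\<Sum>i=1..r. real (?m i choose r)) = real (n choose r)"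
    unfolding n[symmetric] card_cross_edges[OF V assms(1), of c, symmetric] by simp
  ultimately have E': "real (card E) \<le> real (n choose r) - (\<Sum>i=1..r. real (?m i choose r))
      + (real k - 1) * real n"
    using assms(2) by (simp add: of_nat_diff)
  show ?thesis
  proof (cases "r * (r - 1) \<le> n")
    case True
    have "(\<Sum>i\<in>{1..r}. \<Sum>v | v \<in> V \<and> c v = i. 1) = (\<Sum>v\<in>V. 1::nat)"
      by (rule sum.group) (use V c in auto)
    then have "(\<Sum>i=1..r. ?m i) = n"
      using n by simp
    then have sum: "(\<Sum>i=1..r. real (?m i)) = real n"
      by (metis of_nat_sum)
    have "real (r * (r - 1)) \<le> real n"
      using True of_nat_le_iff by blast
    then have "real r * ((real n / real r) gchoose r) \<le> (\<Sum>i=1..r. real (?m i choose r))"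
      using sum_choose_ge_card_mult_gbinomial[of "{1..r}" r ?m] assms(1) sum
      by (simp add: of_nat_diff mult.commute)
    with E' show ?thesis by simp
  next
    case False
    have "real (card E) \<le> real (card {e. e \<subseteq> V \<and> card e = r})"
      using H V by (intro of_nat_mono card_mono) (auto simp: uniform_hypergraph_def)
    then have E1: "real (card E) \<le> real (n choose r)"
      using n_subsets[OF V] n by simp
    show ?thesis
    proof (cases "2 \<le> k")
      case k: True
      have "n \<le> r * r"
        using False by (metis diff_le_self linear mult_le_mono2 order_trans)
      then have "real n \<le> real r * real r"
        by (metis of_nat_le_iff of_nat_mult)
      then have "(real n / real r) gchoose r \<le> real n / real r"
        using assms(1) by (intro gbinomial_le_self) (auto simp: field_simps)
      then have "real r * ((real n / real r) gchoose r) \<le> real n"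
        using assms(1) by (simp add: field_simps)
      also have "\<dots> \<le> (real k - 1) * real n"
        using k mult_right_mono[of 1 "real k - 1" "real n"] by simp
      finally show ?thesis
        using E1 by simp
    next
      case k: False
      then have "real r * ((real n / real r) gchoose r) \<le> 0"
        using side False by (auto simp: mult_le_0_iff)
      moreover have "0 \<le> (real k - 1) * real n"
        using assms(2) by simp
      ultimately show ?thesis
        using E1 by linarith
    qed
  qed
qed

section \<open>Sharpness: orientations, stars and the extremal hypergraph\<close>

lemma swap_permutations_of_set:
  assumes "xs \<in> permutations_of_set A" "i < length xs" "j < length xs"
  shows "xs[i := xs ! j, j := xs ! i] \<in> permutations_of_set A"
  using assms by (auto simp: permutations_of_set_def distinct_swap set_swap)

text \<open>A list with the fewest bad positions has none: an element at a bad position \<open>i\<close>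
  could be swapped with any element of another colour.\<close>

lemma ex_permutation_avoiding_colours:
  assumes "finite e" "card e = r" "\<And>i. i \<in> {1..r} \<Longrightarrow> \<exists>v\<in>e. c v \<noteq> i"
  shows "\<exists>xs\<in>permutations_of_set e. \<forall>i<r. c (xs ! i) \<noteq> Suc i"
proof -
  define bad where "bad xs = {i. i < r \<and> c (xs ! i) = Suc i}" for xs
  have finbad: "finite (bad xs)" for xs
    by (simp add: bad_def)
  have "\<exists>xs. xs \<in> permutations_of_set e"
    using permutations_of_set_empty_iff[of e] assms(1) by blast
  from ex_has_least_nat[of "\<lambda>xs. xs \<in> permutations_of_set e" _ "\<lambda>xs. card (bad xs)"] this
  obtain xs where xs: "xs \<in> permutations_of_set e"
    and least: "\<And>ys. ys \<in> permutations_of_set e \<Longrightarrow> card (bad xs) \<le> card (bad ys)"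
    by blast
  have len: "length xs = r" and set: "set xs = e"
    using xs assms(2) by (auto simp: length_finite_permutations_of_set dest: permutations_of_setD)
  have "bad xs = {}"
  proof (rule ccontr)
    assume "bad xs \<noteq> {}"
    then obtain i where i: "i < r" "c (xs ! i) = Suc i"
      by (auto simp: bad_def)
    obtain j where j: "j < r" "c (xs ! j) \<noteq> Suc i"
      using assms(3)[of "Suc i"] i set len by (auto simp: in_set_conv_nth)
    define ys where "ys = xs[i := xs ! j, j := xs ! i]"
    have "ys \<in> permutations_of_set e"
      unfolding ys_def using xs i j len by (intro swap_permutations_of_set) auto
    moreover have "bad ys \<subset> bad xs"
    proof
      have ij: "i \<noteq> j"
        using i j by auto
      show "bad ys \<subseteq> bad xs"
        using i j len ij by (auto simp: bad_def ys_def nth_list_update split: if_splits)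
      have "i \<in> bad xs" "i \<notin> bad ys"
        using i j len ij by (auto simp: bad_def ys_def nth_list_update)
      then show "bad ys \<noteq> bad xs" by blast
    qed
    ultimately show False
      using least psubset_card_mono[OF finbad] by (meson not_le)
  qed
  with xs show ?thesis
    by (auto simp: bad_def)
qed

text \<open>Only edges of \<open>F v\<close> need to have \<open>v\<close> in position
  \<open>c v\<close>: other colours are available in a cross edge, and a monochromatic edge can put
  any chosen vertex in the position of its colour.\<close>

lemma f_hypergraph_cross_edges_Un_eq_0:
  assumes "finite V" "c \<in> V \<rightarrow> {1..r}"
    and F: "\<And>v e. v \<in> V \<Longrightarrow> e \<in> F v \<Longrightarrow> e \<subseteq> {u \<in> V. c u = c v} \<and> card e = r \<and> v \<in> e"
    and card: "\<And>v. v \<in> V \<Longrightarrow> card (F v) < k"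
  defines "E \<equiv> cross_edges r V c \<union> (\<Union>v\<in>V. F v)"
  shows "uniform_hypergraph r V E" "f_hypergraph r V E k = 0"
proof -
  show H: "uniform_hypergraph r V E"
    using assms(1) F by (fastforce simp: uniform_hypergraph_def E_def cross_edges_def)
  have "\<exists>xs\<in>permutations_of_set e. \<forall>i<r. c (xs ! i) = Suc i \<longrightarrow> e \<in> F (xs ! i)"
    if e: "e \<in> E" for e
  proof -
    have e': "e \<subseteq> V" "card e = r" "finite e"
      using H e assms(1) by (auto simp: uniform_hypergraph_def intro: finite_subset)
    consider "e \<in> cross_edges r V c" | v where "v \<in> V" "e \<in> F v"
      using e by (auto simp: E_def)
    then show ?thesis
    proof cases
      case 1
      have "\<exists>v\<in>e. c v \<noteq> i" if "i \<in> {1..r}" for i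
        using 1 e' that by (auto simp: cross_edges_def)
      from ex_permutation_avoiding_colours[OF e'(3,2) this] show ?thesis
        by blast
    next
      case 2
      obtain xs where xs: "xs \<in> permutations_of_set e"
        using permutations_of_set_empty_iff[of e] e'(3) by blast
      have len: "length xs = r" and set: "set xs = e"
        using xs e' by (auto simp: length_finite_permutations_of_set dest: permutations_of_setD)
      obtain j where j: "j < r" "xs ! j = v"
        using F[OF 2] set len by (metis in_set_conv_nth)
      define i where "i = c v - 1"
      have i: "i < r" "c v = Suc i"
        using assms(2) 2(1) by (auto simp: i_def Pi_iff)
      define ys where "ys = xs[i := xs ! j, j := xs ! i]"
      have ys: "ys \<in> permutations_of_set e"
        unfolding ys_def using xs i j len by (intro swap_permutations_of_set) auto
      then have "length ys = r" "set ys = e"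
        using len by (auto simp: ys_def permutations_of_set_def)
      \<comment> \<open>As \<open>e\<close> has the single colour \<open>Suc i\<close>, index
        \<open>i\<close> is the only one where colour and position agree, and \<open>v\<close> is
        there.\<close>
      then have "c (ys ! l) = Suc i" if "l < r" for l
        using F[OF 2] i that nth_mem[of l ys] by auto
      moreover have "ys ! i = v"
        using i j len by (cases "i = j") (simp_all add: ys_def)
      ultimately show ?thesis
        using ys 2 by (intro bexI[of _ ys]) auto
    qed
  qed
  then obtain D0 where D0: "\<And>e. e \<in> E \<Longrightarrow> D0 e \<in> permutations_of_set e \<and>
      (\<forall>i<r. c (D0 e ! i) = Suc i \<longrightarrow> e \<in> F (D0 e ! i))"
    by metis
  define D where "D = restrict D0 E"
  have "D \<in> orientations E"
    using D0 by (auto simp: orientations_def D_def)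
  moreover have "pos_deg E D (c v) v < k" if v: "v \<in> V" for v
  proof -
    have cv: "c v - 1 < r" "c v = Suc (c v - 1)"
      using assms(2) v by (auto simp: Pi_iff)
    have "finite (F v)"
      by (rule finite_subset[of _ "Pow V"]) (use F[OF v] assms(1) in auto)
    moreover have "{e \<in> E. D e ! (c v - 1) = v} \<subseteq> F v"
    proof
      fix e assume "e \<in> {e \<in> E. D e ! (c v - 1) = v}"
      then have e: "e \<in> E" "D0 e ! (c v - 1) = v"
        by (auto simp: D_def)
      with D0[OF e(1)] cv show "e \<in> F v" by metis
    qed
    ultimately show ?thesis
      unfolding pos_deg_def using card[OF v] by (meson card_mono le_less_trans)
  qed
  ultimately show "f_hypergraph r V E k = 0"
    using assms(2) f_hypergraph_eq_0_iff[OF H] by blast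
qed

text \<open>Arrange \<open>S\<close> as \<open>r\<close> rows of \<open>q\<close> points. The sets \<open>T d z\<close> take the point \<open>z\<close> from every
  row but row \<open>0\<close>, which contributes \<open>z + d\<close> modulo \<open>q\<close>; a vertex in row \<open>a\<close> gets the sets through
  it with shift \<open>d\<close> in \<open>{a * t..<(a + 1) * t}\<close>, so that \<open>d\<close> determines the row.\<close>

lemma ex_disjoint_stars:
  assumes "finite S" "card S = r * q" "2 \<le> r" "r * t \<le> q"
  shows "\<exists>F. (\<forall>v\<in>S. card (F v) = t \<and> (\<forall>e\<in>F v. e \<subseteq> S \<and> card e = r \<and> v \<in> e))
    \<and> disjoint_family_on F S"
proof -
  let ?P = "{..<r} \<times> {..<q}"
  obtain g where g: "bij_betw g ?P S"
    using finite_same_card_bij[of ?P S] assms(1,2) by auto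
  then have inj: "inj_on g ?P" and gS: "\<And>p. p \<in> ?P \<Longrightarrow> g p \<in> S"
    by (auto simp: bij_betw_def)
  define X where "X d z b = (if b = 0 then (z + d) mod q else z)" for d z b :: nat
  define T where "T d z = (\<lambda>b. g (b, X d z b)) ` {..<r}" for d z
  have X: "X d z b < q" if "z < q" for d z b
    using that by (simp add: X_def)
  have mem: "g (b, x) \<in> T d z \<longleftrightarrow> x = X d z b" if "b < r" "x < q" "z < q" for b x d z
  proof
    assume "g (b, x) \<in> T d z"
    then obtain b' where "b' < r" "g (b, x) = g (b', X d z b')"
      by (auto simp: T_def)
    with that X inj have "(b, x) = (b', X d z b')"
      by (intro inj_onD[OF inj]) auto
    then show "x = X d z b" by simp
  qed (use that in \<open>auto simp: T_def\<close>)
  have T: "T d z \<subseteq> S" "card (T d z) = r" if "z < q" for d z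
  proof -
    show "T d z \<subseteq> S"
      using gS X[OF that] by (auto simp: T_def)
    have "inj_on (\<lambda>b. g (b, X d z b)) {..<r}"
      using X[OF that] by (auto intro!: inj_onI dest!: inj_onD[OF inj])
    then show "card (T d z) = r"
      by (simp add: T_def card_image)
  qed
  have T_eq: "d = d' \<and> z = z'" if "T d z = T d' z'" "d < q" "z < q" "d' < q" "z' < q" for d z d' z'
  proof -
    \<comment> \<open>Row 1, which exists because \<open>r \<ge> 2\<close>, determines
      \<open>z\<close>; row 0 then determines \<open>d\<close> modulo \<open>q\<close>.\<close>
    have z: "z = z'"
      using mem[of 1 z z d] mem[of 1 z z' d'] that assms(3) by (simp add: X_def)
    have "(z + d) mod q = (z + d') mod q"
      using mem[of 0 "(z + d) mod q" z d] mem[of 0 "(z + d) mod q" z' d'] that assms(3) z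
      by (simp add: X_def)
    \<comment> \<open>Both summands are below \<open>q\<close>, so reduction subtracts
      \<open>q\<close> at most once.\<close>
    moreover have "(z + e) mod q = (if z + e < q then z + e else z + e - q)" if "e < q" for e
      using that \<open>z < q\<close> by (simp add: mod_if)
    ultimately show ?thesis
      using that z by (auto split: if_splits)
  qed
  \<comment> \<open>The choice of \<open>z\<close> for which \<open>T (a * t + j) z\<close> passes
    through the point \<open>y\<close> of row \<open>a\<close>. In row 0 the shift is just
    \<open>j\<close>, and adding \<open>q - j\<close> undoes it.\<close>
  define w where "w a y j = (if a = 0 then (y + (q - j)) mod q else y)" for a y j :: nat
  have shift: "a * t + j < q" if "a < r" "j < t" for a j
  proof -
    have "a * t + j < Suc a * t"
      using that by simp
    also have "\<dots> \<le> r * t"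
      using that by (intro mult_le_mono1) auto
    finally show ?thesis
      using assms(4) by simp
  qed
  have w: "w a y j < q" "X (a * t + j) (w a y j) a = y" if "a < r" "j < t" "y < q" for a y j
    using that shift[of a j] by (auto simp: w_def X_def mod_add_left_eq)
  define G where "G = (\<lambda>(a, y). (\<lambda>j. T (a * t + j) (w a y j)) ` {..<t})"
  define F where "F v = G (inv_into ?P g v)" for v
  have F_g: "F (g (a, y)) = (\<lambda>j. T (a * t + j) (w a y j)) ` {..<t}" if "a < r" "y < q" for a y
    using that inv_into_f_f[OF inj, of "(a, y)"] by (simp add: F_def G_def)
  have obt: "\<exists>a y. a < r \<and> y < q \<and> v = g (a, y)" if "v \<in> S" for v
    using that g by (auto simp: bij_betw_def)
  show ?thesis
  proof (intro exI[of _ F] conjI ballI)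
    fix v assume "v \<in> S"
    then obtain a y where v: "a < r" "y < q" "v = g (a, y)"
      using obt by blast
    have "inj_on (\<lambda>j. T (a * t + j) (w a y j)) {..<t}"
    proof (rule inj_onI)
      fix i j assume "i \<in> {..<t}" "j \<in> {..<t}" "T (a * t + i) (w a y i) = T (a * t + j) (w a y j)"
      then have "a * t + i = a * t + j"
        using T_eq[of "a * t + i" "w a y i" "a * t + j" "w a y j"] shift w v by auto
      then show "i = j" by simp
    qed
    then show "card (F v) = t"
      using v F_g by (simp add: card_image)
    fix e assume "e \<in> F v"
    then obtain j where j: "j < t" "e = T (a * t + j) (w a y j)"
      using v F_g by auto
    then show "e \<subseteq> S" "card e = r" "v \<in> e"
      using T mem w v by auto
  next
    show "disjoint_family_on F S"
      unfolding disjoint_family_on_def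
    proof (intro ballI impI, rule ccontr)
      fix u v assume uv: "u \<in> S" "v \<in> S" "u \<noteq> v" "F u \<inter> F v \<noteq> {}"
      obtain a y b x where u: "a < r" "y < q" "u = g (a, y)" and v: "b < r" "x < q" "v = g (b, x)"
        using obt uv by metis
      obtain i j where ij: "i < t" "j < t" "T (a * t + i) (w a y i) = T (b * t + j) (w b x j)"
        using uv F_g u v by auto
      then have eq: "a * t + i = b * t + j" "w a y i = w b x j"
        using T_eq[OF ij(3)] shift w u v by auto
      \<comment> \<open>As \<open>i\<close> and \<open>j\<close> are below \<open>t\<close>, the
        quotients are the row numbers.\<close>
      then have "(a * t + i) div t = (b * t + j) div t"
        by simp
      then have ab: "a = b"
        using ij by simp
      have "y = X (a * t + i) (w a y i) a"
        using w(2) u ij(1) by simp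
      also have "\<dots> = X (b * t + j) (w b x j) b"
        unfolding eq unfolding ab ..
      also have "\<dots> = x"
        using w(2) v ij(2) by simp
      finally have "y = x" .
      with ab u v uv show False by simp
    qed
  qed
qed

text \<open>The classes are \<open>r\<close> intervals of length \<open>m = r * q\<close>, each
  arranged as \<open>r\<close> rows of \<open>q\<close> points to supply \<open>k - 1\<close> star
  edges per vertex. The room needed is \<open>r * (k - 1) \<le> q\<close>.\<close>

lemma ex_extremal_hypergraph:
  assumes "2 \<le> r" "r\<^sup>2 dvd n" "(k - 1) * r ^ (2 * r - 1) < n" "1 \<le> k"
  shows "\<exists>(V::nat set) E. uniform_hypergraph r V E \<and> card V = n \<and> f_hypergraph r V E k = 0 \<and>
    real (card E) = real (n choose r) - real r * ((real n / real r) gchoose r)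
      + (real k - 1) * real n"
proof -
  obtain q where q: "n = r\<^sup>2 * q"
    using assms(2) by blast
  define m where "m = r * q"
  have n: "n = r * m"
    by (simp add: q m_def power2_eq_square)
  have m0: "0 < m"
    using assms(3) n by (cases m) auto
  \<comment> \<open>From \<open>r \<ge> 2\<close>; the lower bound on
    \<open>n = r\<^sup>2 * q\<close> thus gives \<open>r * (k - 1) < q\<close>.\<close>
  have "r ^ 3 \<le> r ^ (2 * r - 1)"
    using assms(1) by (intro power_increasing) auto
  then have "(k - 1) * r ^ 3 < r\<^sup>2 * q"
    using assms(3) q by (metis le_less_trans mult_le_mono2)
  then have "r\<^sup>2 * (r * (k - 1)) < r\<^sup>2 * q"
    by (simp add: power2_eq_square power3_eq_cube mult_ac)
  then have rq: "r * (k - 1) \<le> q"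
    by (simp add: mult_less_cancel1)
  define V where "V = {..<n}"
  define c where "c v = Suc (v div m)" for v :: nat
  have c: "c \<in> V \<rightarrow> {1..r}"
    using m0 by (auto simp: c_def V_def n less_mult_imp_div_less Suc_le_eq)
  let ?C = "\<lambda>i. {v \<in> V. c v = i}"
  have cardC: "card (?C i) = m" if "i \<in> {1..r}" for i
  proof -
    have "?C i = {(i - 1) * m..<(i - 1) * m + m}"
    proof (intro set_eqI iffI)
      fix v assume "v \<in> ?C i"
      then have "v div m = i - 1"
        by (auto simp: c_def)
      then show "v \<in> {(i - 1) * m..<(i - 1) * m + m}"
        using div_times_less_eq_dividend[of v m] dividend_less_times_div[OF m0, of v]
        by (auto simp: mult.commute)
    next
      fix v assume v: "v \<in> {(i - 1) * m..<(i - 1) * m + m}"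
      then have "v div m = i - 1"
        by (intro div_nat_eqI) (auto simp: mult.commute)
      then have "c v = i"
        using that by (auto simp: c_def)
      moreover have "v < n"
      proof -
        have "(i - 1) * m + m = i * m"
          using that by (cases i) auto
        also have "\<dots> \<le> n"
          using that by (auto simp: n)
        finally show ?thesis
          using v by auto
      qed
      ultimately show "v \<in> ?C i"
        by (simp add: V_def)
    qed
    then show ?thesis by simp
  qed
  define stars where "stars i F \<longleftrightarrow>
    (\<forall>v\<in>?C i. card (F v) = k - 1 \<and> (\<forall>e\<in>F v. e \<subseteq> ?C i \<and> card e = r \<and> v \<in> e))
    \<and> disjoint_family_on F (?C i)" for i and F :: "nat \<Rightarrow> nat set set"
  have "\<exists>F. stars i F" if "i \<in> {1..r}" for i
    unfolding stars_def
    by (rule ex_disjoint_stars[of _ r q]) (use cardC[OF that] assms(1) rq in \<open>simp_all add: V_def m_def\<close>)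
  then obtain F0 where F0: "\<And>i. i \<in> {1..r} \<Longrightarrow> stars i (F0 i)"
    by metis
  define F where "F v = F0 (c v) v" for v
  have cV: "c v \<in> {1..r}" if "v \<in> V" for v
    using c that by blast
  have cardF: "card (F v) = k - 1" if "v \<in> V" for v
    using F0[unfolded stars_def, OF cV[OF that]] that by (auto simp: F_def)
  have F: "e \<subseteq> ?C (c v) \<and> card e = r \<and> v \<in> e" if "v \<in> V" "e \<in> F v" for v e
    using F0[unfolded stars_def, OF cV[OF that(1)]] that unfolding F_def by blast
  have disj: "F u \<inter> F v = {}" if uv: "u \<in> V" "v \<in> V" "u \<noteq> v" for u v
  proof (cases "c u = c v")
    case True
    then show ?thesis
      using F0[unfolded stars_def, OF cV[OF uv(1)]] uv by (auto simp: F_def disjoint_family_on_def)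
  next
    case False
    \<comment> \<open>A common edge would contain \<open>u\<close> and be monochromatic in both
      colours.\<close>
    then show ?thesis
      using F uv by blast
  qed
  define E where "E = cross_edges r V c \<union> (\<Union>v\<in>V. F v)"
  have V: "finite V" "card V = n"
    by (simp_all add: V_def)
  have H: "uniform_hypergraph r V E" "f_hypergraph r V E k = 0"
    unfolding E_def using f_hypergraph_cross_edges_Un_eq_0[OF V(1) c F, of F k] cardF assms(4) by simp_all
  have finF: "finite (F v)" if "v \<in> V" for v
    by (rule finite_subset[of _ "Pow V"]) (use F[OF that] V in auto)
  have "card (\<Union>v\<in>V. F v) = (\<Sum>v\<in>V. card (F v))"
    using V finF disj by (intro card_UN_disjoint) auto
  also have "\<dots> = (k - 1) * n"
    using cardF V by (simp add: mult.commute)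
  finally have "card (\<Union>v\<in>V. F v) = (k - 1) * n" .
  moreover have "cross_edges r V c \<inter> (\<Union>v\<in>V. F v) = {}"
    using F cV by (fastforce simp: cross_edges_def)
  ultimately have "card E = card (cross_edges r V c) + (k - 1) * n"
    using finite_cross_edges[OF V(1)] finF V by (simp add: E_def card_Un_disjoint)
  moreover have "card (cross_edges r V c) + r * (m choose r) = n choose r"
    using card_cross_edges[OF V(1), of r c] cardC V assms(1) by simp
  then have "real (card (cross_edges r V c)) + real r * real (m choose r) = real (n choose r)"
    by (metis of_nat_add of_nat_mult)
  \<comment> \<open>Here \<open>n / r\<close> is the common class size \<open>m\<close>, so the
    monochromatic sets number exactly \<open>r\<close> times this coefficient.\<close>
  moreover have "(real n / real r) gchoose r = real (m choose r)"
    using assms(1) by (simp add: n binomial_gbinomial)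
  ultimately have "real (card E) = real (n choose r) - real r * ((real n / real r) gchoose r)
      + (real k - 1) * real n"
    using assms(4) by (simp add: of_nat_diff)
  with H V show ?thesis
    by blast
qed

theorem theorem4:
  fixes r k n :: nat
  assumes "1 \<le> r" and "1 \<le> k"
  shows "(\<forall>(V::'a set) E. uniform_hypergraph r V E \<longrightarrow> card V = n \<longrightarrow> f_hypergraph r V E k = 0 \<longrightarrow>
            2 \<le> k \<or> r * (r - 1) \<le> n \<or> (real n / real r) gchoose r \<le> 0 \<longrightarrow>
            real (card E) \<le> real (n choose r) - real r * ((real n / real r) gchoose r)
              + (real k - 1) * real n) \<and>
         (2 \<le> r \<longrightarrow> r\<^sup>2 dvd n \<longrightarrow> (k - 1) * r ^ (2 * r - 1) < n \<longrightarrow>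
            (\<exists>(V::nat set) E. uniform_hypergraph r V E \<and> card V = n \<and> f_hypergraph r V E k = 0 \<and>
              real (card E) = real (n choose r) - real r * ((real n / real r) gchoose r)
                + (real k - 1) * real n))"
  using card_le_of_f_hypergraph_eq_0[OF assms] ex_extremal_hypergraph[of r n k] assms(2) by blast

end
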